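(* Let $G$ be a group of order 2 acting on a finite set $X$, with orbits $X_1,\dots,X_r,X_{r+1},\dots,X_{r+s}$ where $|X_i|=2$ for $1\le i\le r$ and $|X_j|=1$ for $r+1\le j\le r+s$. Then: (i) there is a $G$-perfect nonlinear function $X\to\mathbb F_2$ if and only if $2r\ge s$ and $4\mid(2r+s)$; (ii) if $2r\ge s$ and $4\mid (2r+s)$, then a function $f:X\to\mathbb F_2$ is $G$-perfect nonlinear if and only if $|\{i: 1\le i\le r,\ |X_i\cap f^{-1}(1)|=1\}|=(2r+s)/4$.
   Context: $\mathbb F_2$ is regarded as the additive group of order 2. A function $f:X\to\mathbb F_2$ is $G$-perfect nonlinear if $2$ divides $|X|$ and for every $\alpha\in G\setminus\{1_G\}$ and every $\sigma\in\mathbb F_2$, $|\{x\in X: f(\alpha x)-f(x)=\sigma\}|=|X|/2$. *)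

theory Defs
  imports "HOL-Algebra.Group_Action" "HOL-Library.Z2"
begin

text \<open>
  The field with two elements is the type \<^typ>\<open>bit\<close>. An action of \<open>G\<close> on \<open>X\<close> is given by
  \<open>\<phi>\<close> as in \<^locale>\<open>group_action\<close>, so \<open>\<alpha> x\<close> is \<open>\<phi> \<alpha> x\<close>. A function on \<open>X\<close> is represented by a
  function on the whole type; only its values on \<open>X\<close> matter, since \<open>\<phi> \<alpha>\<close> maps \<open>X\<close> to \<open>X\<close>.
\<close>

definition perfect_nonlinear ::
  "('g, 'm) monoid_scheme \<Rightarrow> 'x set \<Rightarrow> ('g \<Rightarrow> 'x \<Rightarrow> 'x) \<Rightarrow> ('x \<Rightarrow> bit) \<Rightarrow> bool"
  where "perfect_nonlinear G X \<phi> f \<longleftrightarrow>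
    2 dvd card X \<and>
    (\<forall>\<alpha> \<in> carrier G - {\<one>\<^bsub>G\<^esub>}. \<forall>\<sigma>.
      card {x \<in> X. f (\<phi> \<alpha> x) - f x = \<sigma>} = card X div 2)"

end

theory Submission
  imports Defs "HOL-Library.Disjoint_Sets"
begin

text \<open>
  Let \<open>\<alpha>\<close> be the nontrivial element of \<open>G\<close>. The points \<open>x\<close> with \<open>f (\<alpha> x) \<noteq> f x\<close> are exactly those of
  the two-element orbits on which \<open>f\<close> takes both values, so if there are \<open>N\<close> such orbits, then there
  are \<open>2 N\<close> such points, and \<open>f\<close> is perfect nonlinear iff \<open>4 N = card X = 2 r + s\<close>. As \<open>N\<close> can be
  any number from \<open>0\<close> to \<open>r\<close>, both claims follow.
\<close>

lemma bit_diff_eq_one_iff: "a - b = 1 \<longleftrightarrow> a \<noteq> b" for a b :: bit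
  by (cases a; cases b) simp_all

lemma order_two_carrier:
  assumes "group G" "order G = 2"
  obtains a where "a \<noteq> \<one>\<^bsub>G\<^esub>" "carrier G = {\<one>\<^bsub>G\<^esub>, a}"
proof -
  interpret group G by fact
  have "\<one>\<^bsub>G\<^esub> \<in> carrier G" by simp
  moreover obtain x y where "carrier G = {x, y}" "x \<noteq> y"
    using assms(2) by (auto simp: order_def card_2_iff)
  ultimately show thesis
    using that [of x] that [of y] by auto
qed

lemma (in group_action) orbit_order_two:
  assumes "carrier G = {\<one>, a}" "x \<in> E"
  shows "orbit G \<phi> x = {x, \<phi> a x}"
proof -
  have "\<phi> \<one> x = x"
    using assms(2) by (simp add: id_eq_one [symmetric])
  then show ?thesis
    using assms(1) unfolding orbit_def by (auto intro: exI [of _ "\<one>"])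
qed

text \<open>The blocks are indexed injectively, so the sum can run over \<open>I\<close> instead of
  \<open>P\<close>; this later lets it be cut at the index \<open>r\<close>. Taking
  \<open>D = UNIV\<close> counts \<open>X\<close> itself, another choice counts the points where
  \<open>f\<close> changes.\<close>

lemma card_indexed_partition_Int:
  assumes "finite X" "bij_betw Xs I P" "\<Union>P = X" "disjoint P"
  shows "card (X \<inter> D) = (\<Sum>i\<in>I. card (Xs i \<inter> D))"
proof -
  have P: "Xs ` I = P" and inj: "inj_on Xs I"
    using assms(2) by (auto simp: bij_betw_def)
  have "finite P"
    using assms(1,3) by (metis finite_UnionD)
  then have "finite I"
    using assms(2) by (simp add: bij_betw_finite)
  have "finite (Xs i)" if "i \<in> I" for i
    using that P assms(1,3) by (metis Sup_upper finite_subset imageI)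
  moreover have "Xs i \<inter> Xs j = {}" if "i \<in> I" "j \<in> I" "i \<noteq> j" for i j
    using that P inj assms(4) by (metis disjointD imageI inj_onD)
  ultimately have "card (\<Union>i\<in>I. Xs i \<inter> D) = (\<Sum>i\<in>I. card (Xs i \<inter> D))"
    using \<open>finite I\<close> by (intro card_UN_disjoint) blast+
  moreover have "X \<inter> D = (\<Union>i\<in>I. Xs i \<inter> D)"
    using P assms(3) by blast
  ultimately show ?thesis by simp
qed

text \<open>Only \<open>\<alpha> = a\<close> has to be tested, and the fibres of the difference over
  0 and 1 are complementary in \<open>X\<close>. So one has half the size of \<open>X\<close> iff
  the other does, and the single equation also encodes that \<open>card X\<close> is even.\<close>

lemma perfect_nonlinear_order_two_iff:
  assumes "carrier G = {\<one>\<^bsub>G\<^esub>, a}" "a \<noteq> \<one>\<^bsub>G\<^esub>" "finite X"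
  shows "perfect_nonlinear G X \<phi> f \<longleftrightarrow> 2 * card {x \<in> X. f (\<phi> a x) \<noteq> f x} = card X"
proof -
  let ?D = "{x \<in> X. f (\<phi> a x) \<noteq> f x}"
  have one: "{x \<in> X. f (\<phi> a x) - f x = 1} = ?D"
    by (simp only: bit_diff_eq_one_iff)
  have zero: "{x \<in> X. f (\<phi> a x) - f x = 0} = X - ?D"
    by auto
  have nontrivial: "carrier G - {\<one>\<^bsub>G\<^esub>} = {a}"
    using assms(1,2) by auto
  have all_bit: "(\<forall>\<sigma>. Q \<sigma>) \<longleftrightarrow> Q 0 \<and> Q 1" for Q :: "bit \<Rightarrow> bool"
    by (metis bit.exhaust)
  have pn: "perfect_nonlinear G X \<phi> f \<longleftrightarrow>
      2 dvd card X \<and> card (X - ?D) = card X div 2 \<and> card ?D = card X div 2"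
    unfolding perfect_nonlinear_def by (simp only: nontrivial all_bit one zero ball_simps simp_thms)
  have diff: "card (X - ?D) = card X - card ?D"
    using assms(3) by (intro card_Diff_subset) auto
  have arith: "2 dvd n \<and> n - m = n div 2 \<and> m = n div 2 \<longleftrightarrow> 2 * m = n" for m n :: nat
    by (auto elim: dvdE)
  show ?thesis
    unfolding pn diff by (rule arith)
qed

theorem theorem4p7:
  fixes G :: "('g, 'm) monoid_scheme"
    and X :: "'x set"
    and \<phi> :: "'g \<Rightarrow> 'x \<Rightarrow> 'x"
    and Xs :: "nat \<Rightarrow> 'x set"
    and r s :: nat
  assumes "group_action G X \<phi>"
    and "order G = 2"
    and "finite X"
    and "bij_betw Xs {1..r + s} (orbits G X \<phi>)"
    and "\<And>i. i \<in> {1..r} \<Longrightarrow> card (Xs i) = 2"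
    and "\<And>j. j \<in> {r + 1..r + s} \<Longrightarrow> card (Xs j) = 1"
  shows "((\<exists>f. perfect_nonlinear G X \<phi> f) \<longleftrightarrow> 2 * r \<ge> s \<and> 4 dvd (2 * r + s)) \<and>
    (2 * r \<ge> s \<and> 4 dvd (2 * r + s) \<longrightarrow>
      (\<forall>f. perfect_nonlinear G X \<phi> f \<longleftrightarrow>
        card {i \<in> {1..r}. card (Xs i \<inter> f -` {1}) = 1} = (2 * r + s) div 4))"
proof -
  interpret group_action G X \<phi> by fact
  have "group G"
    using group_hom by (simp add: group_hom_def)
  then obtain a where a: "a \<noteq> \<one>\<^bsub>G\<^esub>" "carrier G = {\<one>\<^bsub>G\<^esub>, a}"
    using assms(2) by (rule order_two_carrier)
  have split: "card (X \<inter> D) = (\<Sum>i\<in>{1..r + s}. card (Xs i \<inter> D))" for D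
    by (rule card_indexed_partition_Int)
      (use assms(3,4) disjoint_union orbits_coverture in \<open>auto simp: disjoint_def\<close>)
  have sum_split: "(\<Sum>i\<in>{1..r + s}. h i) = (\<Sum>i\<in>{1..r}. h i) + (\<Sum>i\<in>{r + 1..r + s}. h i)"
    for h :: "nat \<Rightarrow> nat"
    by (rule sum.ub_add_nat) simp
  have "(\<Sum>i\<in>{1..r}. card (Xs i)) = 2 * r" "(\<Sum>j\<in>{r + 1..r + s}. card (Xs j)) = s"
    using assms(5,6) by simp_all
  then have card_X: "card X = 2 * r + s"
    using split [of UNIV] unfolding sum_split by simp

  \<comment> \<open>Distinct orbits are disjoint, so any point of \<open>Xs i\<close> can serve as
    its representative.\<close>
  have Xs_orbit: "Xs i = {x, \<phi> a x}" if "i \<in> {1..r + s}" "x \<in> Xs i" for i x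
  proof -
    have "Xs i \<in> orbits G X \<phi>"
      using that(1) assms(4) by (auto simp: bij_betw_def)
    then obtain y where y: "y \<in> X" "Xs i = orbit G \<phi> y"
      by (auto simp: orbits_def)
    have "x \<in> X"
      using that(2) y orbits_coverture by (auto simp: orbits_def)
    then have "orbit G \<phi> x = orbit G \<phi> y"
      using that(2) y disjoint_union [of "orbit G \<phi> x" "orbit G \<phi> y"] orbit_refl
      by (auto simp: orbits_def)
    then show ?thesis
      using orbit_order_two [OF a(2) \<open>x \<in> X\<close>] y by simp
  qed

  define N where "N f = card {i \<in> {1..r}. card (Xs i \<inter> f -` {1}) = 1}" for f :: "'x \<Rightarrow> bit"
  have card_D: "card {x \<in> X. f (\<phi> a x) \<noteq> f x} = 2 * N f" for f :: "'x \<Rightarrow> bit"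
  proof -
    let ?D = "{x. f (\<phi> a x) \<noteq> f x}"
    \<comment> \<open>The element \<open>a\<close> swaps the two points of the orbit, so either both
      lie in \<open>?D\<close> or neither does. They do iff their values differ, that is, iff
      exactly one value is 1.\<close>
    have big: "card (Xs i \<inter> ?D) = (if card (Xs i \<inter> f -` {1}) = 1 then 2 else 0)"
      if i: "i \<in> {1..r}" for i
    proof -
      obtain x y where xy: "Xs i = {x, y}" "x \<noteq> y"
        using assms(5) [OF i] by (auto simp: card_2_iff)
      have *: "\<phi> a x = y" "\<phi> a y = x"
        using Xs_orbit [of i x] Xs_orbit [of i y] xy i by (auto simp: doubleton_eq_iff)
      show ?thesis
        using xy(2) unfolding xy(1)
        by (cases "f x"; cases "f y") (simp_all add: * Int_insert_left)
    qed
    have small: "card (Xs j \<inter> ?D) = 0" if j: "j \<in> {r + 1..r + s}" for j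
    proof -
      obtain x where x: "Xs j = {x}"
        using assms(6) [OF j] by (auto simp: card_1_singleton_iff)
      then have "\<phi> a x = x"
        using Xs_orbit [of j x] j by auto
      then show ?thesis by (simp add: x)
    qed
    have "card (X \<inter> ?D) = (\<Sum>i\<in>{1..r}. if card (Xs i \<inter> f -` {1}) = 1 then 2 else 0)"
      unfolding split sum_split using big small by simp
    also have "\<dots> = 2 * N f"
      by (simp add: N_def sum.If_cases Int_def)
    finally show ?thesis by (simp add: Int_def)
  qed
  have pn_iff: "perfect_nonlinear G X \<phi> f \<longleftrightarrow> 4 * N f = 2 * r + s" for f
    using perfect_nonlinear_order_two_iff [OF a(2,1) assms(3), of \<phi> f] card_D [of f] card_X by simp
  have N_le: "N f \<le> r" for f
    unfolding N_def by (rule order.trans [OF card_mono [of "{1..r}"]]) auto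

  \<comment> \<open>The witness is the indicator of a set with exactly one point from each of the
    first \<open>k\<close> two-element orbits.\<close>
  have N_surj: "\<exists>f. N f = k" if "k \<le> r" for k
  proof -
    have "\<forall>i\<in>{1..r}. \<exists>x. x \<in> Xs i"
      using assms(5) by (metis card.empty equals0I zero_neq_numeral)
    then obtain p where p: "\<And>i. i \<in> {1..r} \<Longrightarrow> p i \<in> Xs i"
      by metis
    \<comment> \<open>A chosen point \<open>p i\<close> lies in no other two-element orbit, so
      \<open>f\<close> takes the value 1 only at \<open>p i\<close> on \<open>Xs i\<close> for
      \<open>i \<le> k\<close>, and nowhere on \<open>Xs i\<close> for
      \<open>k < i \<le> r\<close>.\<close>
    have eq: "i = j" if "i \<in> {1..r}" "j \<in> {1..r}" "p i \<in> Xs j" for i j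
    proof -
      have "Xs i = Xs j"
        using Xs_orbit [of i "p i"] Xs_orbit [of j "p i"] that p by simp
      with bij_betw_imp_inj_on [OF assms(4)] show ?thesis
        by (rule inj_onD) (use that in simp_all)
    qed
    define f :: "'x \<Rightarrow> bit" where "f x = (if x \<in> p ` {1..k} then 1 else 0)" for x
    have f_one: "f -` {1} = p ` {1..k}"
      by (auto simp: f_def split: if_splits)
    have "Xs i \<inter> f -` {1} = (if i \<le> k then {p i} else {})" if "i \<in> {1..r}" for i
    proof -
      have "j = i" if "1 \<le> j" "j \<le> k" "p j \<in> Xs i" for j
        using that \<open>i \<in> {1..r}\<close> \<open>k \<le> r\<close> by (intro eq) auto
      then show ?thesis
        using that p [of i] unfolding f_one by (cases "i \<le> k") fastforce+
    qed
    then have "{i \<in> {1..r}. card (Xs i \<inter> f -` {1}) = 1} = {1..k}"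
      using \<open>k \<le> r\<close> by (auto split: if_splits)
    then have "N f = k"
      by (simp add: N_def)
    then show ?thesis by blast
  qed

  have "(\<exists>f. perfect_nonlinear G X \<phi> f) \<longleftrightarrow> 2 * r \<ge> s \<and> 4 dvd (2 * r + s)"
  proof
    assume "\<exists>f. perfect_nonlinear G X \<phi> f"
    then obtain f where *: "4 * N f = 2 * r + s"
      using pn_iff by blast
    then have "4 dvd (2 * r + s)"
      by (metis dvd_triv_left)
    \<comment> \<open>From \<open>N f \<le> r\<close> follows \<open>2 * r + s \<le> 4 * r\<close>,
      which is the inequality.\<close>
    then show "2 * r \<ge> s \<and> 4 dvd (2 * r + s)"
      using * N_le [of f] by linarith
  next
    assume *: "2 * r \<ge> s \<and> 4 dvd (2 * r + s)"
    \<comment> \<open>Conversely, \<open>s \<le> 2 * r\<close> bounds the required number of orbits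
      by the \<open>r\<close> available ones.\<close>
    then have "(2 * r + s) div 4 \<le> r"
      by linarith
    then obtain f where "N f = (2 * r + s) div 4"
      using N_surj by blast
    then show "\<exists>f. perfect_nonlinear G X \<phi> f"
      using * pn_iff by (metis dvd_mult_div_cancel)
  qed
  \<comment> \<open>Divisibility makes the truncating \<open>div\<close> exact, so the equation for
    \<open>4 * N f\<close> can be solved for \<open>N f\<close>.\<close>
  moreover have "perfect_nonlinear G X \<phi> f \<longleftrightarrow> N f = (2 * r + s) div 4"
    if "4 dvd (2 * r + s)" for f
    using that pn_iff [of f] by auto
  ultimately show ?thesis
    unfolding N_def by blast
qed

end
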